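(* Let $D$ be a finite oriented graph whose missing graph is $S_x\cup S_y$, where $S_x$ and $S_y$ are stars with distinct centers $x\neq y$ (the two stars may be vertex-disjoint or may share vertices). Then $D$ has a vertex $v$ with $|N^+(v)|\le |N^{++}(v)|$.
   Context: An oriented graph is a finite digraph with no loops and at most one arc between any two vertices. $N^+(v)$ is the out-neighborhood of $v$, and the second out-neighborhood $N^{++}(v)$ is the set of vertices $w\notin N^+(v)\cup\{v\}$ such that $u\to w$ for some $u\in N^+(v)$. Two distinct vertices $u,v$ form a missing edge $uv$ if neither $(u,v)$ nor $(v,u)$ is an arc. The missing graph of $D$ is the graph whose edges are the missing edges of $D$ and whose vertices are the vertices incident to a missing edge. A star $S_x$ with center $x$ and leaves $a_1,\dots,a_k$ ($k\ge 0$) is the graph with vertex set $\{x,a_1,\dots,a_k\}$ and edges $a_ix$. *)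

theory Defs
  imports Main
begin

definition oriented_graph :: "'a set \<Rightarrow> ('a \<times> 'a) set \<Rightarrow> bool" where
  "oriented_graph V A \<longleftrightarrow> finite V \<and> A \<subseteq> V \<times> V \<and>
     (\<forall>v. (v, v) \<notin> A) \<and> (\<forall>u v. (u, v) \<in> A \<longrightarrow> (v, u) \<notin> A)"

definition out_nbhd :: "('a \<times> 'a) set \<Rightarrow> 'a \<Rightarrow> 'a set" where
  "out_nbhd A v = {w. (v, w) \<in> A}"

definition second_out_nbhd :: "('a \<times> 'a) set \<Rightarrow> 'a \<Rightarrow> 'a set" where
  "second_out_nbhd A v =
     {w. w \<notin> out_nbhd A v \<and> w \<noteq> v \<and> (\<exists>u \<in> out_nbhd A v. (u, w) \<in> A)}"

definition missing_edges :: "'a set \<Rightarrow> ('a \<times> 'a) set \<Rightarrow> 'a set set" where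
  "missing_edges V A = {{u, v} | u v. u \<in> V \<and> v \<in> V \<and> u \<noteq> v \<and>
                          (u, v) \<notin> A \<and> (v, u) \<notin> A}"

definition missing_graph :: "'a set \<Rightarrow> ('a \<times> 'a) set \<Rightarrow> 'a set \<times> 'a set set" where
  "missing_graph V A = (\<Union> (missing_edges V A), missing_edges V A)"

text \<open>Star with center x and leaf set L (x not a leaf).\<close>

definition star :: "'a \<Rightarrow> 'a set \<Rightarrow> 'a set \<times> 'a set set" where
  "star x L = (insert x L, {{a, x} | a. a \<in> L})"

definition graph_union :: "'a set \<times> 'a set set \<Rightarrow> 'a set \<times> 'a set set \<Rightarrow> 'a set \<times> 'a set set" where
  "graph_union G H = (fst G \<union> fst H, snd G \<union> snd H)"

end

theory Submission
  imports Defs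
begin

text \<open>
  Complete D to a tournament T and take a median order of T, i.e. one with as many forward arcs as
  possible. By Havet and Thomasse its last vertex f, the feed, has the second neighbourhood property
  in T. Missing edges at f may be reversed into f without losing the median order, so f has the
  property in D unless f gains second neighbours through completing arcs that avoid f.

  By symmetry let T contain (y, x), either as an arc of D or as a convenient orientation of a
  missing edge; here (u, w) is convenient if every in-neighbour of u reaches w within two steps,
  so that adding it creates no second neighbours. Every other missing edge at y is
  directed into y, and a missing edge ax is directed (x, a) if this is convenient, else (a, x).
  Then a feed other than y gains at most y; the exceptions, which gain x, can keep their
  arc to y as compensation. If the gain of y is decisive, sedimentation yields another median order
  in which y is closer to the end, so eventually y is the feed. The feed y gains at most x, and only
  if xy is missing; but then sedimentation would put y before x, making (y, x) a forward arc and
  contradicting the maximality of the original order.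
\<close>

section \<open>Tournaments, median orders and feeds\<close>

definition tournament :: "'a set \<Rightarrow> ('a \<times> 'a) set \<Rightarrow> bool" where
  "tournament V T \<longleftrightarrow> finite V \<and> T \<subseteq> V \<times> V \<and> (\<forall>v. (v, v) \<notin> T) \<and>
     (\<forall>u\<in>V. \<forall>v\<in>V. u \<noteq> v \<longrightarrow> ((u, v) \<in> T \<longleftrightarrow> (v, u) \<notin> T))"

definition forward_arcs :: "('a \<times> 'a) set \<Rightarrow> ('a \<Rightarrow> nat) \<Rightarrow> ('a \<times> 'a) set" where
  "forward_arcs T r = {(u, v) \<in> T. r u < r v}"

text \<open>An order is encoded by injective ranks in which gaps are allowed, so that a set of
  vertices can be moved by shifting its ranks.\<close>

definition median_order :: "'a set \<Rightarrow> ('a \<times> 'a) set \<Rightarrow> ('a \<Rightarrow> nat) \<Rightarrow> bool" where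
  "median_order V T r \<longleftrightarrow> inj_on r V \<and>
     (\<forall>r'. inj_on r' V \<longrightarrow> card (forward_arcs T r') \<le> card (forward_arcs T r))"

definition feed :: "'a set \<Rightarrow> ('a \<Rightarrow> nat) \<Rightarrow> 'a \<Rightarrow> bool" where
  "feed V r f \<longleftrightarrow> f \<in> V \<and> (\<forall>v\<in>V. v \<noteq> f \<longrightarrow> r v < r f)"

text \<open>The good vertices of Havet and Thomasse. In a tournament, any other in-neighbour of
  \<open>f\<close>, called bad, beats every out-neighbour of \<open>f\<close> ranked before
  it.\<close>

definition good_vertices :: "('a \<times> 'a) set \<Rightarrow> ('a \<Rightarrow> nat) \<Rightarrow> 'a \<Rightarrow> 'a set" where
  "good_vertices T r f = {w. (w, f) \<in> T \<and> (\<exists>u. (f, u) \<in> T \<and> (u, w) \<in> T \<and> r u < r w)}"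

text \<open>The shift exceeds every rank on \<open>V\<close>, so \<open>S\<close> lands behind the
  rest of \<open>V\<close> while the order inside \<open>S\<close> and outside \<open>S\<close> is
  kept.\<close>

definition raise :: "'a set \<Rightarrow> 'a set \<Rightarrow> ('a \<Rightarrow> nat) \<Rightarrow> 'a \<Rightarrow> nat" where
  "raise V S r v = (if v \<in> S then r v + Suc (Max (r ` V)) else r v)"

definition reverse_out_arcs :: "'a \<Rightarrow> 'a set \<Rightarrow> ('a \<times> 'a) set \<Rightarrow> ('a \<times> 'a) set" where
  "reverse_out_arcs f R T = (T - {f} \<times> R) \<union> R \<times> {f}"

lemma tournament_finite:
  assumes "tournament V T"
  shows "finite V" "finite T"
  using assms finite_subset[of T "V \<times> V"] unfolding tournament_def by simp_all

lemma tournament_cases: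
  assumes "tournament V T" "u \<in> V" "v \<in> V" "u \<noteq> v"
  shows "(u, v) \<in> T \<and> (v, u) \<notin> T \<or> (v, u) \<in> T \<and> (u, v) \<notin> T"
  using assms unfolding tournament_def by blast

lemma tournament_asym: "tournament V T \<Longrightarrow> (u, v) \<in> T \<Longrightarrow> (v, u) \<notin> T"
  unfolding tournament_def by (metis mem_Sigma_iff subsetD)

lemma out_nbhd_subset: "A \<subseteq> V \<times> V \<Longrightarrow> out_nbhd A v \<subseteq> V"
  unfolding out_nbhd_def by auto

lemma second_out_nbhd_subset: "A \<subseteq> V \<times> V \<Longrightarrow> second_out_nbhd A v \<subseteq> V"
  unfolding second_out_nbhd_def by auto

lemma finite_forward_arcs: "finite T \<Longrightarrow> finite (forward_arcs T r)"
  unfolding forward_arcs_def by (rule finite_subset[of _ T]) auto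

lemma ex_median_order:
  assumes "finite V" "finite T"
  shows "\<exists>r. median_order V T r"
proof -
  obtain r0 :: "'a \<Rightarrow> nat" where "inj_on r0 V"
    using finite_imp_inj_to_nat_seg[OF assms(1)] by blast
  moreover have "\<forall>r. inj_on r V \<longrightarrow> card (forward_arcs T r) < Suc (card T)"
    using assms(2) by (auto simp: forward_arcs_def less_Suc_eq_le intro!: card_mono)
  ultimately show ?thesis
    unfolding median_order_def
    using ex_has_greatest_nat[of "\<lambda>r. inj_on r V" r0 "\<lambda>r. card (forward_arcs T r)" "Suc (card T)"]
    by blast
qed

lemma ex_feed:
  assumes "finite V" "V \<noteq> {}" "inj_on r V"
  shows "\<exists>f. feed V r f"
proof -
  have "Max (r ` V) \<in> r ` V" using assms by simp
  then obtain f where "f \<in> V" "r f = Max (r ` V)" by auto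
  moreover have "r v \<le> Max (r ` V)" if "v \<in> V" for v using that assms(1) by simp
  ultimately show ?thesis
    unfolding feed_def using assms(3) by (metis inj_onD le_neq_implies_less)
qed

section \<open>Moving a set to the end of an order, and sedimentation\<close>

lemma inj_on_raise:
  assumes "finite V" "inj_on r V"
  shows "inj_on (raise V S r) V"
proof (rule inj_onI)
  fix u v assume "u \<in> V" "v \<in> V" "raise V S r u = raise V S r v"
  moreover have "r u \<le> Max (r ` V)" "r v \<le> Max (r ` V)"
    using \<open>u \<in> V\<close> \<open>v \<in> V\<close> assms(1) by auto
  ultimately show "u = v"
    using assms(2) by (auto simp: raise_def inj_on_def split: if_splits)
qed

text \<open>Only pairs of \<open>c\<close> in \<open>S\<close> and a later \<open>m\<close> outside
  \<open>S\<close> change their relative order. Afterwards \<open>m\<close> comes first, so an arc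
  from \<open>m\<close> to \<open>c\<close> is won and an arc from \<open>c\<close> to
  \<open>m\<close> is lost.\<close>

lemma card_forward_arcs_raise:
  assumes "tournament V T" "inj_on r V" "S \<subseteq> V"
  shows "int (card (forward_arcs T (raise V S r))) = int (card (forward_arcs T r)) +
    (\<Sum>m\<in>V - S. \<Sum>c\<in>{c \<in> S. r c < r m}. of_bool ((m, c) \<in> T) - of_bool ((c, m) \<in> T))"
proof -
  let ?F = "forward_arcs T r" and ?F' = "forward_arcs T (raise V S r)"
  note fin = tournament_finite[OF assms(1)]
  have TV: "T \<subseteq> V \<times> V" and irr: "\<And>v. (v, v) \<notin> T"
    using assms(1) unfolding tournament_def by auto
  have le: "r v \<le> Max (r ` V)" if "v \<in> V" for v using that fin by auto
  have ne: "r u \<noteq> r v" if "(u, v) \<in> T" for u v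
    using that assms(2) TV irr by (metis inj_onD mem_Sigma_iff subsetD)
  have finS: "finite {c \<in> S. P c}" for P
    using assms(3) fin by (auto intro: finite_subset)
  have raise_less: "raise V S r u < raise V S r v \<longleftrightarrow>
      (if u \<in> S \<longleftrightarrow> v \<in> S then r u < r v else v \<in> S)" if "(u, v) \<in> T" for u v
    using le[of u] le[of v] that TV by (auto simp: raise_def)
  let ?X = "SIGMA m:V - S. {c \<in> S. r c < r m \<and> (m, c) \<in> T}"
  let ?Y = "SIGMA m:V - S. {c \<in> S. r c < r m \<and> (c, m) \<in> T}"
  have gain: "?F' - ?F = ?X"
    using TV assms(3) ne by (fastforce simp: forward_arcs_def raise_less split: if_splits)
  have loss: "?F - ?F' = prod.swap ` ?Y"
    using TV assms(3) by (fastforce simp: forward_arcs_def raise_less image_iff split: if_splits)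
  have "card (?F - ?F') = card ?Y"
    unfolding loss by (rule card_image) (auto intro: inj_onI)
  \<comment> \<open>Both sides count the union of the two sets of forward arcs.\<close>
  moreover have "card ?F' + card (?F - ?F') = card ?F + card (?F' - ?F)"
    using card_Un_disjoint[of ?F' "?F - ?F'"] card_Un_disjoint[of ?F "?F' - ?F"]
      finite_forward_arcs[OF fin(2)] by (simp add: Un_commute)
  ultimately have "int (card ?F') = int (card ?F) + int (card ?X) - int (card ?Y)"
    using gain by simp
  moreover have "int (card (SIGMA m:V - S. {c \<in> S. r c < r m \<and> P m c})) =
      (\<Sum>m\<in>V - S. \<Sum>c\<in>{c \<in> S. r c < r m}. of_bool (P m c))" for P
  proof -
    have "(\<Sum>c\<in>{c \<in> S. r c < r m}. of_bool (P m c)) = int (card {c \<in> S. r c < r m \<and> P m c})" for m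
      using finS[of "\<lambda>c. r c < r m"] by (simp add: Collect_conj_eq Int_assoc)
    moreover have "card (SIGMA m:V - S. {c \<in> S. r c < r m \<and> P m c}) =
        (\<Sum>m\<in>V - S. card {c \<in> S. r c < r m \<and> P m c})"
      using fin finS by (intro card_SigmaI) auto
    ultimately show ?thesis by simp
  qed
  ultimately show ?thesis by (simp add: sum_subtractf)
qed

text \<open>The order in the second claim is the sedimentation of Havet and Thomasse. The sums over
  final segments show that every bad in-neighbour can be moved in front at no loss.\<close>

lemma feed_of_median_order:
  assumes T: "tournament V T" and med: "median_order V T r" and feed: "feed V r f"
  defines "N \<equiv> out_nbhd T f" and "G \<equiv> good_vertices T r f"
  shows "card N \<le> card G"
    and "card N = card G \<Longrightarrow> median_order V T (raise V (N \<union> G) r)"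
proof -
  note fin = tournament_finite[OF T]
  have TV: "T \<subseteq> V \<times> V" using T unfolding tournament_def by auto
  have inj: "inj_on r V" using med unfolding median_order_def by auto
  have fV: "f \<in> V" and r_f: "\<And>v. v \<in> V \<Longrightarrow> v \<noteq> f \<Longrightarrow> r v < r f"
    using feed unfolding feed_def by auto
  have NV: "N \<subseteq> V" and GV: "G \<subseteq> V" and NG: "N \<inter> G = {}" and fNG: "f \<notin> N \<union> G"
    using TV tournament_asym[OF T] unfolding N_def G_def out_nbhd_def good_vertices_def by blast+
  \<comment> \<open>\<open>e m c\<close> is the gain from moving \<open>c\<close> behind
    \<open>m\<close>, and \<open>s t m\<close> the gain from moving \<open>S t\<close> behind
    \<open>m\<close>. As \<open>e f\<close> is 1 on \<open>N\<close> and -1 on \<open>G\<close>,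
    \<open>\<delta> t\<close> is the excess of out-neighbours over good vertices at ranks from
    \<open>t\<close> on.\<close>
  define e :: "'a \<Rightarrow> 'a \<Rightarrow> int" where "e m c = of_bool ((m, c) \<in> T) - of_bool ((c, m) \<in> T)" for m c
  define S where "S t = {c \<in> N \<union> G. t \<le> r c}" for t
  define \<delta> where "\<delta> t = (\<Sum>c\<in>S t. e f c)" for t
  define s where "s t m = (\<Sum>c\<in>{c \<in> S t. r c < r m}. e m c)" for t m
  have SV: "S t \<subseteq> V" for t using NV GV unfolding S_def by auto
  have finS: "finite (S t)" for t using SV fin(1) by (rule finite_subset)
  have raised: "int (card (forward_arcs T (raise V (S t) r))) =
      int (card (forward_arcs T r)) + (\<Sum>m\<in>V - S t. s t m)" for t
    unfolding s_def e_def by (rule card_forward_arcs_raise[OF T inj SV])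
  have sum_le: "(\<Sum>m\<in>V - S t. s t m) \<le> 0" for t
    using raised[of t] inj_on_raise[OF fin(1) inj, of "S t"] med
    unfolding median_order_def by fastforce
  have s_f: "s t f = \<delta> t" for t
  proof -
    have "{c \<in> S t. r c < r f} = S t" using r_f SV fNG unfolding S_def by blast
    then show ?thesis unfolding s_def \<delta>_def by simp
  qed
  \<comment> \<open>Such an \<open>m\<close> is a bad in-neighbour of \<open>f\<close>. It gains at
    least as much as \<open>f\<close> from each \<open>c\<close> before it: it beats those in
    \<open>N\<close>, and \<open>f\<close> gets only -1 from those in \<open>G\<close>. The
    subtracted term accounts for the rest of \<open>S t\<close>.\<close>
  have s_other: "s t m \<ge> \<delta> t - \<delta> (max t (r m))" if m: "m \<in> V - S t" "m \<noteq> f" for t m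
  proof -
    have split: "S t = {c \<in> S t. r c < r m} \<union> S (max t (r m))" unfolding S_def by auto
    have "\<delta> t = (\<Sum>c\<in>{c \<in> S t. r c < r m}. e f c) + \<delta> (max t (r m))"
      unfolding \<delta>_def
      by (subst split, rule sum.union_disjoint) (auto simp: finS, auto simp: S_def)
    moreover have "(\<Sum>c\<in>{c \<in> S t. r c < r m}. e f c) \<le> s t m"
      unfolding s_def
    proof (rule sum_mono)
      fix c assume c: "c \<in> {c \<in> S t. r c < r m}"
      have "m \<notin> N \<union> G" using m c unfolding S_def by auto
      then have bad: "(m, f) \<in> T" "m \<notin> G"
        using tournament_cases[OF T, of m f] m fV unfolding N_def out_nbhd_def by auto
      have cV: "c \<in> V" "c \<noteq> m" using c SV by auto
      show "e f c \<le> e m c"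
      proof (cases "c \<in> N")
        case True
        then have "(f, c) \<in> T" unfolding N_def out_nbhd_def by simp
        then have "(c, m) \<notin> T" using bad c unfolding G_def good_vertices_def by blast
        then have "(m, c) \<in> T" using tournament_cases[OF T, of m c] m cV by auto
        then show ?thesis using \<open>(c, m) \<notin> T\<close> by (simp add: e_def)
      next
        case False
        then have "c \<in> G" using c unfolding S_def by auto
        then have "(c, f) \<in> T" "(f, c) \<notin> T"
          using False unfolding G_def good_vertices_def N_def out_nbhd_def by auto
        then show ?thesis by (simp add: e_def)
      qed
    qed
    ultimately show ?thesis by linarith
  qed
  \<comment> \<open>Take the last \<open>t0\<close> with positive excess. Raising
    \<open>S t0\<close> gains \<open>\<delta> t0\<close> at \<open>f\<close> and loses nothing at
    any bad vertex, which contradicts the median order.\<close>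
  have \<delta>_le: "\<delta> t \<le> 0" for t
  proof (rule ccontr)
    assume "\<not> \<delta> t \<le> 0"
    moreover have "\<delta> t' \<le> 0" if "t' > Max (r ` V)" for t'
    proof -
      have "r c < t'" if "c \<in> V" for c
        using that \<open>t' > Max (r ` V)\<close> fin(1) by (meson Max_ge finite_imageI imageI le_less_trans)
      then have "S t' = {}" using NV GV unfolding S_def by fastforce
      then show ?thesis unfolding \<delta>_def by simp
    qed
    ultimately obtain t0 where t0: "\<delta> t0 > 0" "\<And>t'. t' > t0 \<Longrightarrow> \<delta> t' \<le> 0"
      using ex_has_greatest_nat[of "\<lambda>t. \<delta> t > 0" t id "Suc (Max (r ` V))"]
      by (metis id_apply leD less_Suc_eq_le linorder_not_le)
    have "s t0 m \<ge> 0" if "m \<in> V - S t0 - {f}" for m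
      using s_other[of m t0] t0(1) t0(2)[of "max t0 (r m)"] that by (cases "r m \<le> t0") auto
    then have "(\<Sum>m\<in>V - S t0 - {f}. s t0 m) \<ge> 0" by (rule sum_nonneg)
    moreover have "(\<Sum>m\<in>V - S t0. s t0 m) = s t0 f + (\<Sum>m\<in>V - S t0 - {f}. s t0 m)"
      using fin fV fNG by (intro sum.remove) (auto simp: S_def)
    ultimately show False using sum_le[of t0] s_f[of t0] t0(1) by linarith
  qed
  have S0: "S 0 = N \<union> G" unfolding S_def by auto
  have "\<delta> 0 = (\<Sum>c\<in>N. e f c) + (\<Sum>c\<in>G. e f c)"
    unfolding \<delta>_def S0 using NV GV fin(1) NG by (intro sum.union_disjoint) (auto intro: finite_subset)
  also have "(\<Sum>c\<in>N. e f c) = (\<Sum>c\<in>N. 1)"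
    using NV fNG fV tournament_cases[OF T, of f]
    by (intro sum.cong) (auto simp: N_def out_nbhd_def e_def)
  also have "(\<Sum>c\<in>G. e f c) = (\<Sum>c\<in>G. - 1)"
    using NG by (intro sum.cong) (auto simp: N_def out_nbhd_def G_def good_vertices_def e_def)
  finally have \<delta>0: "\<delta> 0 = int (card N) - int (card G)" by simp
  show "card N \<le> card G" using \<delta>_le[of 0] \<delta>0 by simp
  assume "card N = card G"
  then have "\<delta> 0 = 0" using \<delta>0 by simp
  \<comment> \<open>With total excess 0, \<open>f\<close> contributes nothing, and a bad
    \<open>m\<close> at least minus the excess from \<open>r m\<close> on, which is nonnegative by
    \<open>\<delta>_le\<close>.\<close>
  have "(\<Sum>m\<in>V - S 0. s 0 m) \<ge> 0"
  proof (rule sum_nonneg)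
    fix m assume "m \<in> V - S 0"
    then show "s 0 m \<ge> 0"
      using s_other[of m 0] s_f[of 0] \<delta>_le[of "max 0 (r m)"] \<open>\<delta> 0 = 0\<close> by (cases "m = f") auto
  qed
  then have "card (forward_arcs T (raise V (N \<union> G) r)) \<ge> card (forward_arcs T r)"
    using raised[of 0] S0 by simp
  then show "median_order V T (raise V (N \<union> G) r)"
    using med inj_on_raise[OF fin(1) inj] unfolding median_order_def by (meson le_trans)
qed

section \<open>Reversing out-arcs of the feed\<close>

lemma out_nbhd_reverse_out_arcs:
  assumes "f \<notin> R"
  shows "out_nbhd (reverse_out_arcs f R T) f = out_nbhd T f - R"
  using assms unfolding reverse_out_arcs_def out_nbhd_def by auto

lemma tournament_reverse_out_arcs:
  assumes "tournament V T" "f \<in> V" "R \<subseteq> out_nbhd T f"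
  shows "tournament V (reverse_out_arcs f R T)"
proof -
  have TV: "T \<subseteq> V \<times> V" and irr: "\<And>v. (v, v) \<notin> T"
    using assms(1) unfolding tournament_def by auto
  have R: "u \<in> V \<and> u \<noteq> f \<and> (f, u) \<in> T \<and> (u, f) \<notin> T" if "u \<in> R" for u
    using that assms(3) TV irr tournament_asym[OF assms(1)] unfolding out_nbhd_def by blast
  have "(u, v) \<in> reverse_out_arcs f R T \<longleftrightarrow> (v, u) \<notin> reverse_out_arcs f R T"
    if "u \<in> V" "v \<in> V" "u \<noteq> v" for u v
    using tournament_cases[OF assms(1) that] R[of u] R[of v] that
    unfolding reverse_out_arcs_def by auto
  moreover have "reverse_out_arcs f R T \<subseteq> V \<times> V" "(v, v) \<notin> reverse_out_arcs f R T" for v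
    using assms(2) TV irr R unfolding reverse_out_arcs_def by auto
  ultimately show ?thesis
    using tournament_finite(1)[OF assms(1)] unfolding tournament_def by blast
qed

text \<open>The feed is last, so the reversed arcs all become forward in \<open>r\<close>, a gain of
  \<open>card R\<close>; no order can gain more. Hence an order that is optimal for
  \<open>T'\<close> is optimal for \<open>T\<close> and gains the full amount, which requires all of
  \<open>R\<close> before \<open>f\<close>.\<close>

lemma median_order_reverse_out_arcs:
  assumes T: "tournament V T" and med: "median_order V T r" and feed: "feed V r f"
    and R: "R \<subseteq> out_nbhd T f"
  defines "T' \<equiv> reverse_out_arcs f R T"
  shows "median_order V T' r"
    and "median_order V T' r' \<Longrightarrow> median_order V T r'"
    and "median_order V T' r' \<Longrightarrow> u \<in> R \<Longrightarrow> r' u < r' f"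
proof -
  note fin = tournament_finite[OF T]
  have TV: "T \<subseteq> V \<times> V" and irr: "\<And>v. (v, v) \<notin> T"
    using T unfolding tournament_def by auto
  have RV: "R \<subseteq> V" and fR: "f \<notin> R" using R TV irr unfolding out_nbhd_def by auto
  have finR: "finite R" using RV fin(1) by (rule finite_subset)
  have r_f: "r u < r f" if "u \<in> R" for u
    using that feed RV fR unfolding feed_def by (metis subsetD)
  have asym: "(u, f) \<notin> T" if "u \<in> R" for u
    using that R tournament_asym[OF T] unfolding out_nbhd_def by blast
  have card_R: "card (B \<times> {f}) = card B" for B :: "'a set"
    by (simp add: card_cartesian_product)
  have "forward_arcs T' r = forward_arcs T r \<union> R \<times> {f}"
    using r_f unfolding T'_def forward_arcs_def reverse_out_arcs_def by fastforce
  moreover have "forward_arcs T r \<inter> R \<times> {f} = {}"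
    using asym unfolding forward_arcs_def by auto
  ultimately have at_r: "card (forward_arcs T' r) = card (forward_arcs T r) + card R"
    using finite_forward_arcs[OF fin(2)] finR by (simp add: card_Un_disjoint card_R)
  have upper: "card (forward_arcs T' q) \<le> card (forward_arcs T q) + card R" for q
  proof -
    have "forward_arcs T' q \<subseteq> forward_arcs T q \<union> R \<times> {f}"
      unfolding T'_def forward_arcs_def reverse_out_arcs_def by auto
    then have "card (forward_arcs T' q) \<le> card (forward_arcs T q \<union> R \<times> {f})"
      using finite_forward_arcs[OF fin(2)] finR by (intro card_mono) auto
    then show ?thesis
      using card_Un_le[of "forward_arcs T q" "R \<times> {f}"] by (simp add: card_R)
  qed
  show "median_order V T' r"
    using med upper at_r unfolding median_order_def by (metis add_le_cancel_right le_trans)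
  assume med': "median_order V T' r'"
  then have ge: "card (forward_arcs T r) + card R \<le> card (forward_arcs T' r')"
    using at_r med unfolding median_order_def by metis
  then have "card (forward_arcs T r) \<le> card (forward_arcs T r')" using upper[of r'] by simp
  then show "median_order V T r'"
    using med med' unfolding median_order_def by (meson le_trans)
  assume u: "u \<in> R"
  show "r' u < r' f"
  proof (rule ccontr)
    assume "\<not> r' u < r' f"
    moreover have "r' u \<noteq> r' f"
      using med' u RV fR feed unfolding median_order_def feed_def by (metis inj_onD subsetD)
    ultimately have less: "r' f < r' u" by simp
    have "forward_arcs T' r' \<subseteq> (forward_arcs T r' - {(f, u)}) \<union> (R - {u}) \<times> {f}"
      using less u unfolding T'_def forward_arcs_def reverse_out_arcs_def by auto
    then have "card (forward_arcs T' r') \<le> card ((forward_arcs T r' - {(f, u)}) \<union> (R - {u}) \<times> {f})"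
      using finite_forward_arcs[OF fin(2)] finR by (intro card_mono) auto
    also have "\<dots> \<le> card (forward_arcs T r' - {(f, u)}) + card (R - {u})"
      using card_Un_le[of "forward_arcs T r' - {(f, u)}" "(R - {u}) \<times> {f}"] by (simp only: card_R)
    also have "\<dots> < card (forward_arcs T r') + card R"
      using u finR finite_forward_arcs[OF fin(2)]
      by (intro add_le_less_mono card_Diff1_le card_Diff1_less) auto
    also have "\<dots> \<le> card (forward_arcs T r) + card R"
      using med med' unfolding median_order_def by auto
    finally show False using ge by simp
  qed
qed

text \<open>Here \<open>z\<close> is a second out-neighbour that is not to be counted. Discounting
  it hurts only if \<open>z\<close> is good and the inequality at the feed is tight; then
  sedimentation applies and moves \<open>z\<close> closer to the end.\<close>

lemma feed_or_sediment:
  assumes T: "tournament V T" and med: "median_order V T r" and feed: "feed V r f"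
    and R: "R \<subseteq> out_nbhd T f"
  defines "T' \<equiv> reverse_out_arcs f R T"
  obtains (second_nbhd) "card (out_nbhd T' f) \<le> card (second_out_nbhd T' f - {z})"
  | (sediment) r' where "median_order V T r'" "\<And>u. u \<in> R \<Longrightarrow> r' u < r' f" "r' f < r' z"
      "z \<in> second_out_nbhd T' f" "card {v \<in> V. r' z < r' v} < card {v \<in> V. r z < r v}"
proof -
  let ?N = "out_nbhd T' f" and ?G = "good_vertices T' r f"
  note fin = tournament_finite[OF T]
  have fV: "f \<in> V" using feed unfolding feed_def by simp
  have T': "tournament V T'"
    unfolding T'_def by (rule tournament_reverse_out_arcs[OF T fV R])
  have med': "median_order V T' r"
    unfolding T'_def by (rule median_order_reverse_out_arcs(1)[OF T med feed R])
  note le = feed_of_median_order(1)[OF T' med' feed]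
  have T'V: "T' \<subseteq> V \<times> V" using T' unfolding tournament_def by simp
  have G_sub: "?G \<subseteq> second_out_nbhd T' f"
    using tournament_asym[OF T'] unfolding good_vertices_def second_out_nbhd_def out_nbhd_def
    by blast
  have fin2: "finite (second_out_nbhd T' f)"
    using second_out_nbhd_subset[OF T'V] fin(1) by (rule finite_subset)
  have finG: "finite ?G" using G_sub fin2 by (rule finite_subset)
  show thesis
  proof (cases "z \<in> ?G \<and> card ?N = card ?G")
    case False
    have "card ?N \<le> card (?G - {z})"
      using False le finG by (cases "z \<in> ?G") auto
    also have "\<dots> \<le> card (second_out_nbhd T' f - {z})"
      using G_sub fin2 by (intro card_mono) auto
    finally show ?thesis by (rule second_nbhd)
  next
    case True
    define r' where "r' = raise V (?N \<union> ?G) r"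
    have med2: "median_order V T' r'"
      unfolding r'_def using feed_of_median_order(2)[OF T' med' feed] True by simp
    have fNG: "f \<notin> ?N \<union> ?G"
      using tournament_asym[OF T'] unfolding out_nbhd_def good_vertices_def by blast
    have zV: "z \<in> V" "z \<noteq> f" using True fNG T'V unfolding good_vertices_def by auto
    have le_Max: "r v \<le> Max (r ` V)" if "v \<in> V" for v using that fin(1) by simp
    \<comment> \<open>Whatever follows \<open>z\<close> in the new order was raised with it and
      followed it before, whereas \<open>f\<close> no longer does.\<close>
    have "{v \<in> V. r' z < r' v} \<subseteq> {v \<in> V. r z < r v} - {f}"
      using True fNG le_Max unfolding r'_def raise_def by (fastforce split: if_splits)
    moreover have "f \<in> {v \<in> V. r z < r v}" using feed zV unfolding feed_def by auto
    ultimately have "{v \<in> V. r' z < r' v} \<subset> {v \<in> V. r z < r v}" by auto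
    then have "card {v \<in> V. r' z < r' v} < card {v \<in> V. r z < r v}"
      using fin(1) by (intro psubset_card_mono) auto
    moreover have "r' f < r' z"
      using True fNG le_Max[OF fV] unfolding r'_def raise_def by auto
    ultimately show ?thesis
      using sediment[of r'] True G_sub med2
        median_order_reverse_out_arcs(2,3)[OF T med feed R, folded T'_def, of r'] by blast
  qed
qed

section \<open>Convenient orientations and the completion to a tournament\<close>

definition convenient :: "('a \<times> 'a) set \<Rightarrow> 'a \<Rightarrow> 'a \<Rightarrow> bool" where
  "convenient A u w \<longleftrightarrow>
     (\<forall>v. (v, u) \<in> A \<longrightarrow> v \<noteq> w \<longrightarrow> w \<in> out_nbhd A v \<union> second_out_nbhd A v)"

definition missing :: "'a set \<Rightarrow> ('a \<times> 'a) set \<Rightarrow> 'a \<Rightarrow> 'a \<Rightarrow> bool" where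
  "missing V A u v \<longleftrightarrow> u \<in> V \<and> v \<in> V \<and> u \<noteq> v \<and> (u, v) \<notin> A \<and> (v, u) \<notin> A"

lemma missing_sym: "missing V A u v \<longleftrightarrow> missing V A v u"
  unfolding missing_def by auto

text \<open>An arc from \<open>v\<close> to \<open>w\<close> would let \<open>v\<close> reach
  \<open>b\<close> through \<open>w\<close>, and the opposite arc would let \<open>w\<close> reach
  \<open>a\<close> through \<open>v\<close>. So witnesses against both orientations of a missing
  edge \<open>ab\<close> form a missing edge themselves.\<close>

lemma not_convenient_missing:
  assumes "A \<subseteq> V \<times> V"
    and "(v, a) \<in> A" "v \<noteq> b" "b \<notin> out_nbhd A v \<union> second_out_nbhd A v"
    and "(w, b) \<in> A" "w \<noteq> a" "a \<notin> out_nbhd A w \<union> second_out_nbhd A w"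
  shows "missing V A v w"
proof -
  have "v \<in> V" "w \<in> V" "v \<noteq> w" using assms unfolding out_nbhd_def by auto
  moreover have "(v, w) \<notin> A" "(w, v) \<notin> A"
    using assms(2-7) unfolding out_nbhd_def second_out_nbhd_def by auto
  ultimately show ?thesis unfolding missing_def by simp
qed

definition two_star_completion ::
    "'a set \<Rightarrow> ('a \<times> 'a) set \<Rightarrow> 'a \<Rightarrow> 'a \<Rightarrow> ('a \<times> 'a) set" where
  "two_star_completion V A x y = A \<union> {(u, v). missing V A u v \<and>
     (u = y \<and> v = x \<or> v = y \<and> u \<noteq> x \<or>
      u = x \<and> v \<noteq> y \<and> convenient A x v \<or> v = x \<and> u \<noteq> y \<and> \<not> convenient A x u)}"

lemma tournament_two_star_completion:
  assumes "oriented_graph V A" "x \<noteq> y"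
    and "\<And>u v. missing V A u v \<Longrightarrow> u = x \<or> u = y \<or> v = x \<or> v = y"
  shows "tournament V (two_star_completion V A x y)"
proof -
  have 1: "two_star_completion V A x y \<subseteq> V \<times> V" "finite V"
    using assms(1) unfolding two_star_completion_def missing_def oriented_graph_def by auto
  have 2: "(v, v) \<notin> two_star_completion V A x y" for v
    using assms(1) unfolding two_star_completion_def missing_def oriented_graph_def by auto
  have 3: "(u, v) \<in> two_star_completion V A x y \<longleftrightarrow> (v, u) \<notin> two_star_completion V A x y"
    if "u \<in> V" "v \<in> V" "u \<noteq> v" for u v
  proof (cases "missing V A u v")
    case True
    then have "(u, v) \<notin> A" "(v, u) \<notin> A" "missing V A v u" "u \<noteq> v" unfolding missing_def by auto
    then show ?thesis
      using True assms(2) assms(3)[OF True] unfolding two_star_completion_def by auto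
  next
    case False
    then show ?thesis
      using that assms(1) unfolding two_star_completion_def missing_def oriented_graph_def by auto
  qed
  show ?thesis unfolding tournament_def using 1 2 3 by blast
qed

section \<open>The induction over median orders of the completion\<close>

lemma two_stars_second_nbhd:
  assumes D: "oriented_graph V A" and V: "x \<in> V" "y \<in> V" "x \<noteq> y"
    and stars: "\<And>u v. missing V A u v \<Longrightarrow> u = x \<or> u = y \<or> v = x \<or> v = y"
    and yx: "(y, x) \<in> A \<or> missing V A x y \<and> convenient A y x"
  shows "\<exists>v\<in>V. card (out_nbhd A v) \<le> card (second_out_nbhd A v)"
proof -
  define T where "T = two_star_completion V A x y"
  have T: "tournament V T"
    unfolding T_def by (rule tournament_two_star_completion[OF D V(3) stars])
  note fin = tournament_finite[OF T]
  have AV: "A \<subseteq> V \<times> V" and A_asym: "\<And>u v. (u, v) \<in> A \<Longrightarrow> (v, u) \<notin> A"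
    and A_irr: "\<And>v. (v, v) \<notin> A" using D unfolding oriented_graph_def by auto
  have TV: "T \<subseteq> V \<times> V" using T unfolding tournament_def by simp
  have AT: "A \<subseteq> T" unfolding T_def two_star_completion_def by auto
  have fin2: "finite (second_out_nbhd A v)" for v
    using second_out_nbhd_subset[OF AV] fin(1) by (rule finite_subset)
  have finN: "finite (out_nbhd A v)" for v
    using out_nbhd_subset[OF AV] fin(1) by (rule finite_subset)
  have xy: "(x, y) \<notin> A" using yx A_asym unfolding missing_def by auto
  have in_y: "(b, y) \<in> T" if "missing V A b y" "b \<noteq> x" for b
    using that unfolding T_def two_star_completion_def by auto
  txt \<open>A two-path through a completing arc can only end in x or y; if it ends in x at a new
    second neighbour, its start is y or is joined to y by a missing edge.\<close>
  have gain: "w \<in> out_nbhd A f \<union> second_out_nbhd A f \<or> w = y \<or>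
      w = x \<and> missing V A u x \<and> u \<noteq> y \<and> x \<notin> out_nbhd A f \<and>
        (f = y \<or> missing V A f y \<and> (y, x) \<in> A \<and> u \<notin> out_nbhd A y \<union> second_out_nbhd A y)"
    if u: "(f, u) \<in> A" and w: "(u, w) \<in> T" "w \<noteq> f" for f u w
  proof (cases "(u, w) \<in> A \<or> w = y \<or> w \<in> out_nbhd A f \<union> second_out_nbhd A f")
    case True
    then show ?thesis using u w(2) unfolding out_nbhd_def second_out_nbhd_def by auto
  next
    case False
    then have uw: "missing V A u w" "w \<noteq> y"
      and new: "w \<notin> out_nbhd A f \<union> second_out_nbhd A f"
      using w(1) unfolding T_def two_star_completion_def by auto
    consider "u = y" "w = x" | "u = x" "convenient A x w" | "w = x" "u \<noteq> y" "\<not> convenient A x u"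
      using w(1) False unfolding T_def two_star_completion_def by auto
    then show ?thesis
    proof cases
      case 1
      then have "convenient A y x" using yx uw unfolding missing_def by auto
      then show ?thesis using u w(2) 1 new unfolding convenient_def by auto
    next
      case 2
      then show ?thesis using u w(2) new unfolding convenient_def by auto
    next
      case 3
      \<comment> \<open>\<open>g\<close> shows that \<open>(x, u)\<close> is not convenient, and
        \<open>f\<close> does the same for \<open>(u, x)\<close>. So \<open>fg\<close> is a missing
        edge; it avoids \<open>x\<close> and must contain \<open>y\<close>.\<close>
      then obtain g where g: "(g, x) \<in> A" "g \<noteq> u" "u \<notin> out_nbhd A g \<union> second_out_nbhd A g"
        unfolding convenient_def by auto
      have "missing V A f g"
        using not_convenient_missing[OF AV u _ _ g(1)] g new w(2) 3 by auto
      moreover have "f \<noteq> x" "g \<noteq> x" using 3 w(2) g A_irr by auto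
      ultimately have "f = y \<or> g = y" using stars by blast
      then show ?thesis
        using \<open>missing V A f g\<close> uw 3 g new by auto
    qed
  qed
  \<comment> \<open>\<open>B\<close> collects the out-neighbours that \<open>f\<close> keeps: those
    in \<open>A\<close>, in one case together with \<open>y\<close>.\<close>
  have N_eq: "out_nbhd (reverse_out_arcs f (out_nbhd T f - B) T) f = B"
    if "B \<subseteq> out_nbhd T f" for f B
    using that T out_nbhd_reverse_out_arcs[of f "out_nbhd T f - B" T]
    unfolding out_nbhd_def tournament_def by auto
  have second_D: "w \<noteq> f \<and> w \<notin> B \<and> (\<exists>u\<in>B. (u, w) \<in> T)"
    if "w \<in> second_out_nbhd (reverse_out_arcs f (out_nbhd T f - B) T) f" "B \<subseteq> out_nbhd T f" for f B w
    using that(1) N_eq[OF that(2)] T unfolding second_out_nbhd_def tournament_def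
    by (auto simp: reverse_out_arcs_def out_nbhd_def)
  have NT: "out_nbhd A f \<subseteq> out_nbhd T f" for f using AT unfolding out_nbhd_def by auto
  have "\<exists>v\<in>V. card (out_nbhd A v) \<le> card (second_out_nbhd A v)" if "median_order V T r" for r
    using that
  \<comment> \<open>The measure counts the vertices after \<open>y\<close>; sedimentation with
    \<open>z = y\<close> lowers it.\<close>
  proof (induction "card {v \<in> V. r y < r v}" arbitrary: r rule: less_induct)
    case less
    then have "inj_on r V" unfolding median_order_def by simp
    then obtain f where feed: "feed V r f" using ex_feed[OF fin(1)] V(1) by blast
    then have fV: "f \<in> V" unfolding feed_def by simp
    let ?N = "out_nbhd A f"
    let ?R = "out_nbhd T f - ?N"
    let ?T = "reverse_out_arcs f ?R T"
    have N: "out_nbhd ?T f = ?N" by (rule N_eq[OF NT])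
    note step = feed_or_sediment[OF T less.prems feed, of ?R]
    show ?case
    proof (cases "f = y")
      case True
      have sub: "second_out_nbhd ?T f - {x} \<subseteq> second_out_nbhd A f"
        using second_D[OF _ NT, of _ f] gain[of f] True unfolding out_nbhd_def by blast
      show ?thesis
      proof (rule step[of x])
        show "?R \<subseteq> out_nbhd T f" by auto
      next
        assume "card (out_nbhd ?T f) \<le> card (second_out_nbhd ?T f - {x})"
        also have "\<dots> \<le> card (second_out_nbhd A f)" using sub fin2 by (rule card_mono[rotated])
        finally show ?thesis using N fV by auto
      next
        fix r' :: "'a \<Rightarrow> nat"
        assume r': "\<And>u. u \<in> ?R \<Longrightarrow> r' u < r' f" "r' f < r' x" "x \<in> second_out_nbhd ?T f"
        \<comment> \<open>A second out-neighbour is not an out-neighbour, so \<open>(y, x)\<close>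
          is a completing arc and was reversed. That forces \<open>x\<close> before \<open>y\<close>
          in \<open>r'\<close>, although sedimentation puts it after.\<close>
        have "(y, x) \<notin> A" using second_D[OF r'(3) NT] True unfolding out_nbhd_def by auto
        then have "x \<in> ?R"
          using yx True missing_sym[of V A x y]
          unfolding T_def two_star_completion_def out_nbhd_def by auto
        then show ?thesis using r'(1)[of x] r'(2) by simp
      qed
    next
      case f: False
      show ?thesis
      proof (cases "missing V A f y \<and> (y, x) \<in> A \<and> x \<notin> ?N \<and>
          (\<exists>a. (f, a) \<in> A \<and> missing V A a x \<and> a \<noteq> y \<and> a \<notin> out_nbhd A y \<union> second_out_nbhd A y)")
        case True
        then obtain a where a: "(f, a) \<in> A" "missing V A a x" "a \<noteq> y"
          "a \<notin> out_nbhd A y \<union> second_out_nbhd A y" by auto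
        have fx: "f \<noteq> x" using True xy unfolding missing_def by auto
        \<comment> \<open>Keeping the completing arc \<open>(f, y)\<close> adds one out-neighbour,
          which balances the possible gain of \<open>x\<close>.\<close>
        let ?B = "insert y ?N"
        let ?T2 = "reverse_out_arcs f (out_nbhd T f - ?B) T"
        have B: "?B \<subseteq> out_nbhd T f"
          using NT in_y True fx unfolding out_nbhd_def by auto
        have "second_out_nbhd ?T2 f \<subseteq> insert x (second_out_nbhd A f)"
        proof
          fix w assume "w \<in> second_out_nbhd ?T2 f"
          from second_D[OF this B] obtain u where w: "w \<noteq> f" "w \<notin> ?B" "u \<in> ?B" "(u, w) \<in> T"
            by auto
          show "w \<in> insert x (second_out_nbhd A f)"
          proof (cases "u = y")
            case u: True
            show ?thesis
            proof (cases "w = x")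
              case False
              have yw: "(y, w) \<in> A"
                using w(4) u False w(2) V(3) unfolding T_def two_star_completion_def by auto
              \<comment> \<open>\<open>y\<close> does not reach \<open>a\<close> within two steps,
                so \<open>w\<close> cannot beat \<open>a\<close>. As \<open>aw\<close> avoids both
                centres it is not missing; hence \<open>f\<close> reaches \<open>w\<close> through
                \<open>a\<close>, and keeping \<open>(f, y)\<close> adds nothing here.\<close>
              then have "(w, a) \<notin> A" "w \<noteq> a"
                using a(3,4) unfolding second_out_nbhd_def out_nbhd_def by auto
              moreover have "\<not> missing V A a w"
                using stars[of a w] a(2,3) w(2) False unfolding missing_def by auto
              ultimately have "(a, w) \<in> A" using yw AV a(2) unfolding missing_def by auto
              then show ?thesis using a(1) w unfolding second_out_nbhd_def out_nbhd_def by auto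
            qed auto
          next
            case False
            then have "(f, u) \<in> A" using w(3) unfolding out_nbhd_def by auto
            then show ?thesis using gain[of f u w] w by auto
          qed
        qed
        then have "card (second_out_nbhd ?T2 f) \<le> card (insert x (second_out_nbhd A f))"
          using fin2 by (intro card_mono) auto
        then have "card (second_out_nbhd ?T2 f) \<le> Suc (card (second_out_nbhd A f))"
          using fin2[of f] by (simp add: card_insert_if split: if_splits)
        moreover have "card (out_nbhd ?T2 f) = Suc (card ?N)"
          using N_eq[OF B] finN True unfolding missing_def out_nbhd_def by auto
        moreover have "card (out_nbhd ?T2 f) \<le> card (second_out_nbhd ?T2 f)"
        proof -
          have R2: "out_nbhd T f - ?B \<subseteq> out_nbhd T f" by auto
          \<comment> \<open>A \<open>z\<close> outside the second out-neighbourhood, such as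
            \<open>f\<close>, excludes the \<open>sediment\<close> alternative and makes the
            discount void.\<close>
          obtain z where z: "z \<notin> second_out_nbhd ?T2 f"
            unfolding second_out_nbhd_def by blast
          show ?thesis
            by (rule feed_or_sediment[OF T less.prems feed R2, of z]) (use z in auto)
        qed
        ultimately have "card ?N \<le> card (second_out_nbhd A f)" by linarith
        then show ?thesis using fV by blast
      next
        case False
        \<comment> \<open>As \<open>f\<close> differs from \<open>y\<close>, a gain of
          \<open>x\<close> would be exactly the configuration that this case excludes.\<close>
        have sub: "second_out_nbhd ?T f - {y} \<subseteq> second_out_nbhd A f"
        proof
          fix w assume w: "w \<in> second_out_nbhd ?T f - {y}"
          then obtain u where u: "w \<noteq> f" "w \<notin> ?N" "(f, u) \<in> A" "(u, w) \<in> T"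
            using second_D[OF _ NT, of w f] unfolding out_nbhd_def by blast
          then show "w \<in> second_out_nbhd A f"
            using gain[OF u(3,4,1)] w f False by blast
        qed
        show ?thesis
        proof (rule step[of y])
          show "?R \<subseteq> out_nbhd T f" by auto
        next
          assume "card (out_nbhd ?T f) \<le> card (second_out_nbhd ?T f - {y})"
          also have "\<dots> \<le> card (second_out_nbhd A f)" using sub fin2 by (rule card_mono[rotated])
          finally show ?thesis using N fV by auto
        next
          fix r' :: "'a \<Rightarrow> nat"
          assume "median_order V T r'" "card {v \<in> V. r' y < r' v} < card {v \<in> V. r y < r v}"
          then show ?thesis using less.hyps by blast
        qed
      qed
    qed
  qed
  then show ?thesis using ex_median_order[OF fin] by blast
qed

section \<open>Assigning the roles of the two centres\<close>

theorem theorem3p1: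
  fixes V :: "'a set" and A :: "('a \<times> 'a) set" and x y :: 'a and Lx Ly :: "'a set"
  assumes "oriented_graph V A"
    and "finite Lx" and "finite Ly"
    and "x \<notin> Lx" and "y \<notin> Ly"
    and "x \<noteq> y"
    and "missing_graph V A = graph_union (star x Lx) (star y Ly)"
  shows "\<exists>v \<in> V. card (out_nbhd A v) \<le> card (second_out_nbhd A v)"
proof -
  have AV: "A \<subseteq> V \<times> V" and A_irr: "\<And>v. (v, v) \<notin> A" using assms(1) unfolding oriented_graph_def by auto
  have vs: "insert x Lx \<union> insert y Ly = \<Union> (missing_edges V A)"
    and es: "missing_edges V A = {{a, x} | a. a \<in> Lx} \<union> {{a, y} | a. a \<in> Ly}"
    using arg_cong[OF assms(7), of fst] arg_cong[OF assms(7), of snd]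
    by (simp_all only: missing_graph_def graph_union_def star_def fst_conv snd_conv)
  \<comment> \<open>The equality of vertex sets puts both centres into \<open>V\<close>, even one
    without leaves.\<close>
  have "\<Union> (missing_edges V A) \<subseteq> V" unfolding missing_edges_def by auto
  then have xV: "x \<in> V" and yV: "y \<in> V" unfolding vs[symmetric] by auto
  have stars: "u = x \<or> u = y \<or> v = x \<or> v = y" if "missing V A u v" for u v
  proof -
    have "{u, v} \<in> missing_edges V A"
      using that unfolding missing_def missing_edges_def by blast
    then show ?thesis unfolding es by (auto simp: doubleton_eq_iff)
  qed
  \<comment> \<open>If both orientations failed, the witnesses \<open>v\<close> and \<open>w\<close>
    would form a missing edge that avoids \<open>x\<close> and \<open>y\<close>.\<close>
  have "convenient A x y \<or> convenient A y x" if "missing V A x y"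
  proof (rule ccontr)
    assume "\<not> (convenient A x y \<or> convenient A y x)"
    then obtain v w where vw: "(v, x) \<in> A" "v \<noteq> y" "y \<notin> out_nbhd A v \<union> second_out_nbhd A v"
      "(w, y) \<in> A" "w \<noteq> x" "x \<notin> out_nbhd A w \<union> second_out_nbhd A w"
      unfolding convenient_def by blast
    then have "missing V A v w" by (rule not_convenient_missing[OF AV])
    then show False using stars[of v w] vw A_irr by auto
  qed
  then consider "(y, x) \<in> A \<or> missing V A x y \<and> convenient A y x"
    | "(x, y) \<in> A \<or> missing V A y x \<and> convenient A x y"
    using xV yV assms(6) unfolding missing_def by blast
  then show ?thesis
  proof cases
    case 1
    then show ?thesis using two_stars_second_nbhd[OF assms(1) xV yV assms(6)] stars by blast
  next
    case 2
    have "u = y \<or> u = x \<or> v = y \<or> v = x" if "missing V A u v" for u v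
      using stars[OF that] by blast
    then show ?thesis
      using 2 two_stars_second_nbhd[OF assms(1) yV xV assms(6)[symmetric]] by blast
  qed
qed

end
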